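(* Let $n\geqslant 1$ and let $f\colon\mathbb{A}^n\to\mathbb{A}^n$ be a morphism of affine spaces over $\mathbb{C}$ given by homogeneous polynomials, $f=(P_1,\dots,P_n)$ with each $P_i\in\mathbb{C}[X_1,\dots,X_n]$ homogeneous (of possibly different degrees). If $f^{-1}(0)=\{0\}$, then $f$ is finite.
   Context: The condition $f^{-1}(0)=\{0\}$ is an equality of sets of $\mathbb{C}$-points: the only common zero of $P_1,\dots,P_n$ in $\mathbb{C}^n$ is the origin. "Finite" means finite as a morphism of schemes, i.e. $\mathbb{C}[X_1,\dots,X_n]$ is a finitely generated module over the subring $\mathbb{C}[P_1,\dots,P_n]$ (equivalently, over $\mathbb{C}[Y_1,\dots,Y_n]$ acting via $Y_i\mapsto P_i$). *)

theory Defs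
  imports "HOL-Analysis.Analysis" "HOL-Library.Poly_Mapping"
begin

text \<open>
  The polynomial ring over the complex numbers in variables indexed by a finite type: a monomial
  is an exponent vector, a polynomial is a finitely supported map from monomials to coefficients,
  and the ring structure is the convolution product of \<^theory>\<open>HOL-Library.Poly_Mapping\<close>.
\<close>

type_synonym 'n cpoly = "('n \<Rightarrow>\<^sub>0 nat) \<Rightarrow>\<^sub>0 complex"

definition Const :: "complex \<Rightarrow> 'n::finite cpoly" where
  "Const c = Poly_Mapping.single 0 c"

definition Var :: "'n::finite \<Rightarrow> 'n cpoly" where
  "Var i = Poly_Mapping.single (Poly_Mapping.single i 1) 1"

definition mdeg :: "('n::finite \<Rightarrow>\<^sub>0 nat) \<Rightarrow> nat" where
  "mdeg m = (\<Sum>i\<in>UNIV. Poly_Mapping.lookup m i)"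

text \<open>The zero polynomial is homogeneous of every degree.\<close>

definition homogeneous :: "nat \<Rightarrow> 'n::finite cpoly \<Rightarrow> bool" where
  "homogeneous d p \<longleftrightarrow> (\<forall>m\<in>Poly_Mapping.keys p. mdeg m = d)"

text \<open>
  \<open>peval h x p\<close> is the value of \<open>p\<close> at the point \<open>x\<close> of a commutative algebra with structure
  map \<open>h\<close>. It is used for complex points and for substitution of polynomials.
\<close>

definition peval :: "(complex \<Rightarrow> 'a::comm_ring_1) \<Rightarrow> ('n::finite \<Rightarrow> 'a) \<Rightarrow> 'n cpoly \<Rightarrow> 'a" where
  "peval h x p = (\<Sum>m\<in>Poly_Mapping.keys p.
     h (Poly_Mapping.lookup p m) * (\<Prod>i\<in>UNIV. x i ^ Poly_Mapping.lookup m i))"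

text \<open>
  A family \<open>P\<close> of polynomials in the variables \<open>'n\<close>, indexed by \<open>'m\<close>, is a morphism from affine
  \<open>'n\<close>-space to affine \<open>'m\<close>-space. \<open>point_map P\<close> is its effect on complex points and
  \<open>comorphism P\<close> the homomorphism of coordinate rings sending the variable \<open>Y i\<close> to \<open>P i\<close>.
\<close>

definition point_map :: "('m::finite \<Rightarrow> 'n::finite cpoly) \<Rightarrow> complex ^ 'n \<Rightarrow> complex ^ 'm" where
  "point_map P x = (\<chi> i. peval (\<lambda>c. c) (\<lambda>j. x $ j) (P i))"

definition comorphism :: "('m::finite \<Rightarrow> 'n::finite cpoly) \<Rightarrow> 'm cpoly \<Rightarrow> 'n cpoly" where
  "comorphism P = peval Const P"

definition pullback_scale ::
    "('m::finite \<Rightarrow> 'n::finite cpoly) \<Rightarrow> 'm cpoly \<Rightarrow> 'n cpoly \<Rightarrow> 'n cpoly" where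
  "pullback_scale P q r = comorphism P q * r"

text \<open>The coordinate ring of the source is a finitely generated module over that of the target
  (\<open>module_pullback_scale\<close> below shows that this is indeed a module structure).\<close>

definition finite_morphism :: "('m::finite \<Rightarrow> 'n::finite cpoly) \<Rightarrow> bool" where
  "finite_morphism P \<longleftrightarrow> (\<exists>B. finite B \<and> module.span (pullback_scale P) B = UNIV)"

lemma Const_hom:
  "Const 0 = 0" "Const 1 = 1" "Const (a + b) = Const a + Const b" "Const (a * b) = Const a * Const b"
  by (simp_all add: Const_def single_add mult_single)

lemma update_eq_single_add:
  "k \<notin> Poly_Mapping.keys p \<Longrightarrow> Poly_Mapping.update k c p = Poly_Mapping.single k c + p"
  by (rule poly_mapping_eqI) (auto simp: lookup_update lookup_add lookup_single in_keys_iff when_def)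

context
  fixes h :: "complex \<Rightarrow> 'a::comm_ring_1" and x :: "'n::finite \<Rightarrow> 'a"
  assumes h: "h 0 = 0" "h 1 = 1" "\<And>a b. h (a + b) = h a + h b" "\<And>a b. h (a * b) = h a * h b"
begin

lemma peval_superset:
  assumes "finite K" "Poly_Mapping.keys p \<subseteq> K"
  shows "peval h x p = (\<Sum>m\<in>K. h (Poly_Mapping.lookup p m) * (\<Prod>i\<in>UNIV. x i ^ Poly_Mapping.lookup m i))"
  unfolding peval_def using assms by (intro sum.mono_neutral_left) (auto simp: in_keys_iff h)

lemma peval_add: "peval h x (p + q) = peval h x p + peval h x q"
proof -
  let ?K = "Poly_Mapping.keys p \<union> Poly_Mapping.keys q"
  have "Poly_Mapping.keys (p + q) \<subseteq> ?K" by (rule Poly_Mapping.keys_add)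
  then show ?thesis
    by (simp add: peval_superset[of ?K] lookup_add h distrib_right sum.distrib)
qed

lemma peval_single:
  "peval h x (Poly_Mapping.single m c) = h c * (\<Prod>i\<in>UNIV. x i ^ Poly_Mapping.lookup m i)"
  by (subst peval_superset[of "{m}"]) auto

lemma peval_zero: "peval h x 0 = 0"
  by (simp add: peval_def)

lemma peval_one: "peval h x 1 = 1"
  using peval_single[of 0 1] by (simp add: h)

lemma peval_Const: "peval h x (Const c) = h c"
  by (simp add: Const_def peval_single)

lemma peval_Var: "peval h x (Var j) = x j"
proof -
  have "(\<Prod>i\<in>UNIV. x i ^ Poly_Mapping.lookup (Poly_Mapping.single j 1) i)
      = (\<Prod>i\<in>UNIV. if i = j then x i else 1)"
    by (intro prod.cong) (auto simp: lookup_single when_def)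
  then show ?thesis by (simp add: Var_def peval_single h)
qed

lemma peval_mult_single:
  "peval h x (Poly_Mapping.single m c * q) = peval h x (Poly_Mapping.single m c) * peval h x q"
proof (induction q rule: update_induct)
  case const
  then show ?case by (simp add: peval_zero)
next
  case (update q k d)
  then show ?case
    by (simp add: update_eq_single_add distrib_left peval_add mult_single)
      (simp add: peval_single h lookup_add power_add prod.distrib mult_ac)
qed

lemma peval_mult: "peval h x (p * q) = peval h x p * peval h x q"
proof (induction p rule: update_induct)
  case const
  then show ?case by (simp add: peval_zero)
next
  case (update p k c)
  then show ?case
    by (simp add: update_eq_single_add distrib_right peval_add peval_mult_single)
qed

end

lemma comorphism_hom:
  "comorphism P (p + q) = comorphism P p + comorphism P q"
  "comorphism P (p * q) = comorphism P p * comorphism P q"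
  "comorphism P 1 = 1"
  "comorphism P (Const c) = Const c"
  "comorphism P (Var i) = P i"
  by (simp_all add: comorphism_def peval_add peval_mult peval_one peval_Const peval_Var Const_hom)

lemma module_pullback_scale: "module (pullback_scale P)"
  by unfold_locales (simp_all add: pullback_scale_def comorphism_hom algebra_simps)

end

theory Submission
  imports Defs "HOL-Computational_Algebra.Fundamental_Theorem_Algebra"
begin

text \<open>
  By the Nullstellensatz some power of every variable lies in the ideal generated by the \<open>P i\<close>.
  Hence a monomial with a large exponent is a combination of the \<open>P i\<close>, and since these are
  homogeneous of positive degree, the coefficients can be taken homogeneous of smaller degree.
  By induction on the degree (graded Nakayama) the finitely many monomials with small exponents
  generate the polynomial ring. The Nullstellensatz is proved by the cardinality argument available
  over the uncountable field of complex numbers.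
\<close>

section \<open>Ideals maximal among those containing no power of a given element\<close>

text \<open>Ideals of a ring are the subspaces of the ring as a module over itself.\<close>

interpretation ideal: module "(*) :: 'a::comm_ring_1 \<Rightarrow> 'a \<Rightarrow> 'a"
  by unfold_locales (simp_all add: algebra_simps)

text \<open>As a rewrite rule \<open>scale_scale\<close> reverses associativity and loops with \<open>mult.assoc\<close>.\<close>

declare ideal.scale_scale [simp del]

text \<open>Zorn's lemma. By maximality, adjoining any \<open>g\<close> outside \<open>J\<close>
  brings in a power of \<open>f\<close>, so \<open>g\<close> is invertible modulo \<open>J\<close>
  up to powers of \<open>f\<close>: \<open>J\<close> corresponds to a maximal ideal of the
  localization at \<open>f\<close>. Working with such \<open>J\<close> avoids adjoining a new
  variable to invert \<open>f\<close>.\<close>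

lemma ideal_maximal_avoiding_powers:
  fixes I :: "'a::comm_ring_1 set"
  assumes I: "ideal.subspace I" and avoid: "\<And>k. f ^ k \<notin> I"
  obtains J where "ideal.subspace J" "I \<subseteq> J" "\<And>k. f ^ k \<notin> J"
    "\<And>g. g \<notin> J \<Longrightarrow> \<exists>h k. f ^ k - g * h \<in> J"
proof -
  define \<A> where "\<A> = {J. ideal.subspace J \<and> I \<subseteq> J \<and> (\<forall>k. f ^ k \<notin> J)}"
  have "\<exists>M\<in>\<A>. \<forall>X\<in>\<A>. M \<subseteq> X \<longrightarrow> X = M"
  proof (rule subset_Zorn_nonempty)
    show "\<A> \<noteq> {}" using I avoid by (auto simp: \<A>_def)
    fix \<C> assume ne: "\<C> \<noteq> {}" and ch: "subset.chain \<A> \<C>"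
    have sub: "\<And>X. X \<in> \<C> \<Longrightarrow> ideal.subspace X \<and> I \<subseteq> X \<and> (\<forall>k. f ^ k \<notin> X)"
      using ch by (auto simp: subset.chain_def \<A>_def)
    have "ideal.subspace (\<Union>\<C>)"
    proof (rule ideal.subspaceI)
      show "0 \<in> \<Union>\<C>" using ne sub ideal.subspace_0 by blast
    next
      fix a b assume "a \<in> \<Union>\<C>" "b \<in> \<Union>\<C>"
      then obtain X Y where XY: "a \<in> X" "X \<in> \<C>" "b \<in> Y" "Y \<in> \<C>" by blast
      then have "X \<subseteq> Y \<or> Y \<subseteq> X" using ch by (auto simp: subset.chain_def)
      then show "a + b \<in> \<Union>\<C>" using XY sub ideal.subspace_add by blast
    next
      fix c a assume "a \<in> \<Union>\<C>"
      then show "c * a \<in> \<Union>\<C>" using sub ideal.subspace_scale by blast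
    qed
    then show "\<Union>\<C> \<in> \<A>" using ne sub by (auto simp: \<A>_def)
  qed
  then obtain J where J: "J \<in> \<A>" and max: "\<And>X. X \<in> \<A> \<Longrightarrow> J \<subseteq> X \<Longrightarrow> X = J" by blast
  have sJ: "ideal.subspace J" using J by (simp add: \<A>_def)
  have "\<exists>h k. f ^ k - g * h \<in> J" if g: "g \<notin> J" for g
  proof (rule ccontr)
    assume no: "\<not> ?thesis"
    \<comment> \<open>The ideal generated by \<open>J\<close> and \<open>g\<close>. By
      \<open>no\<close> it still contains no power of \<open>f\<close>, which contradicts the
      maximality of \<open>J\<close>.\<close>
    define X where "X = {x. \<exists>h. x - g * h \<in> J}"
    have "ideal.subspace X"
    proof (rule ideal.subspaceI)
      show "0 \<in> X" unfolding X_def using ideal.subspace_0[OF sJ] by (auto intro!: exI[of _ 0])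
    next
      fix a b assume "a \<in> X" "b \<in> X"
      then obtain h h' where "a - g * h \<in> J" "b - g * h' \<in> J" by (auto simp: X_def)
      then have "(a - g * h) + (b - g * h') \<in> J" by (rule ideal.subspace_add[OF sJ])
      then show "a + b \<in> X" unfolding X_def by (auto intro!: exI[of _ "h + h'"] simp: algebra_simps)
    next
      fix c a assume "a \<in> X"
      then obtain h where "a - g * h \<in> J" by (auto simp: X_def)
      then have "c * (a - g * h) \<in> J" by (rule ideal.subspace_scale[OF sJ])
      then show "c * a \<in> X" unfolding X_def by (auto intro!: exI[of _ "c * h"] simp: algebra_simps)
    qed
    moreover have JX: "J \<subseteq> X" unfolding X_def by (auto intro!: exI[of _ 0])
    ultimately have "X \<in> \<A>" using J no by (auto simp: \<A>_def X_def)
    then have "X = J" using max JX by blast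
    moreover have "g \<in> X"
      unfolding X_def using ideal.subspace_0[OF sJ] by (auto intro!: exI[of _ 1])
    ultimately show False using g by simp
  qed
  then show ?thesis using that[of J] J by (auto simp: \<A>_def)
qed

text \<open>If neither factor lay in \<open>J\<close>, both would divide powers of \<open>f\<close>
  modulo \<open>J\<close>, hence so would \<open>g * h\<close>, and a power of \<open>f\<close>
  would lie in \<open>J\<close>.\<close>

lemma ideal_maximal_avoiding_powers_prime:
  fixes J :: "'a::comm_ring_1 set"
  assumes J: "ideal.subspace J" and avoid: "\<And>k. f ^ k \<notin> J"
    and unit: "\<And>g. g \<notin> J \<Longrightarrow> \<exists>h k. f ^ k - g * h \<in> J"
    and gh: "g * h \<in> J"
  shows "g \<in> J \<or> h \<in> J"
proof (rule ccontr)
  assume "\<not> (g \<in> J \<or> h \<in> J)"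
  then obtain a k b l where *: "f ^ k - g * a \<in> J" "f ^ l - h * b \<in> J" using unit by blast
  have "f ^ l * (f ^ k - g * a) + g * a * (f ^ l - h * b) + a * b * (g * h) \<in> J"
    by (intro ideal.subspace_add[OF J] ideal.subspace_scale[OF J] * gh)
  also have "f ^ l * (f ^ k - g * a) + g * a * (f ^ l - h * b) + a * b * (g * h) = f ^ (k + l)"
    by (simp add: algebra_simps power_add)
  finally show False using avoid by blast
qed

section \<open>Monomials, and induction over the generators of the polynomial ring\<close>

lemma finite_bounded_exponents: "finite {m :: 'n::finite \<Rightarrow>\<^sub>0 nat. \<forall>i. Poly_Mapping.lookup m i < N i}"
proof (rule finite_imageD)
  show "inj_on Poly_Mapping.lookup {m :: 'n \<Rightarrow>\<^sub>0 nat. \<forall>i. Poly_Mapping.lookup m i < N i}"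
    by (auto intro!: inj_onI poly_mapping_eqI)
  show "finite (Poly_Mapping.lookup ` {m :: 'n \<Rightarrow>\<^sub>0 nat. \<forall>i. Poly_Mapping.lookup m i < N i})"
    by (rule finite_subset[of _ "Pi\<^sub>E UNIV (\<lambda>i. {..<N i})"]) (auto intro!: finite_PiE)
qed

lemma cpoly_eq_sum_singles:
  fixes p :: "'n cpoly"
  shows "p = (\<Sum>m\<in>Poly_Mapping.keys p. Poly_Mapping.single m (Poly_Mapping.lookup p m))"
  by (rule poly_mapping_eqI)
    (auto simp: lookup_sum lookup_single when_def in_keys_iff if_distrib sum.delta)

lemma Const_mult_single: "Const a * Poly_Mapping.single m c = Poly_Mapping.single m (a * c)"
  by (simp add: Const_def mult_single)

lemma Const_inverse: "a \<noteq> 0 \<Longrightarrow> Const (inverse a) * Const a = 1"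
  by (simp flip: Const_hom(4) add: Const_hom(2))

lemma Var_power: "Var i ^ k = Poly_Mapping.single (Poly_Mapping.single i k) 1"
  by (induction k) (simp_all add: Var_def mult_single single_add[symmetric])

lemma single_eq_Const_mult_Vars:
  "Poly_Mapping.single m c = Const c * (\<Prod>i\<in>UNIV. Var i ^ Poly_Mapping.lookup m i)"
proof -
  have "(\<Prod>i\<in>S. Var i ^ Poly_Mapping.lookup m i)
      = Poly_Mapping.single (\<Sum>i\<in>S. Poly_Mapping.single i (Poly_Mapping.lookup m i)) 1"
    if "finite S" for S
    using that by induction (simp_all add: Var_power mult_single)
  moreover have "(\<Sum>i\<in>UNIV. Poly_Mapping.single i (Poly_Mapping.lookup m i)) = m"
    by (rule poly_mapping_eqI) (auto simp: lookup_sum lookup_single when_def sum.delta)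
  ultimately show ?thesis by (simp add: Const_mult_single)
qed

lemma cpoly_induct [case_names Const Var add mult]:
  fixes p :: "'n::finite cpoly"
  assumes Const: "\<And>c. Q (Const c)" and Var: "\<And>i. Q (Var i)"
    and add: "\<And>p q. Q p \<Longrightarrow> Q q \<Longrightarrow> Q (p + q)" and mult: "\<And>p q. Q p \<Longrightarrow> Q q \<Longrightarrow> Q (p * q)"
  shows "Q p"
proof -
  have one: "Q 1" and zero: "Q 0" using Const[of 1] Const[of 0] by (simp_all add: Const_hom)
  have pow: "Q (Var i ^ k)" for i k by (induction k) (simp_all add: one Var mult)
  have "Q (\<Prod>i\<in>S. Var i ^ Poly_Mapping.lookup m i)" if "finite S" for S m
    using that by induction (simp_all add: one pow mult)
  then have single: "Q (Poly_Mapping.single m c)" for m c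
    by (simp add: single_eq_Const_mult_Vars Const mult)
  have "Q (\<Sum>m\<in>S. Poly_Mapping.single m (Poly_Mapping.lookup p m))" if "finite S" for S
    using that by induction (simp_all add: zero single add)
  then show ?thesis using cpoly_eq_sum_singles[of p] finite_keys[of p] by metis
qed

text \<open>Congruence modulo \<open>J\<close> to the value at \<open>x\<close> is compatible with
  sums and products, so it passes from the variables to all polynomials.\<close>

lemma minus_Const_eval_in_ideal:
  fixes p :: "'n::finite cpoly"
  assumes J: "ideal.subspace J" and x: "\<And>i. Var i - Const (x i) \<in> J"
  shows "p - Const (peval (\<lambda>c. c) x p) \<in> J"
proof (induction p rule: cpoly_induct)
  case (Const c)
  then show ?case using ideal.subspace_0[OF J] by (simp add: peval_Const)
next
  case (Var i)
  then show ?case using x by (simp add: peval_Var)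
next
  case (add p q)
  then show ?case using ideal.subspace_add[OF J add]
    by (simp add: peval_add Const_hom algebra_simps)
next
  case (mult p q)
  let ?p = "Const (peval (\<lambda>c. c) x p)" and ?q = "Const (peval (\<lambda>c. c) x q)"
  have "q * (p - ?p) + ?p * (q - ?q) \<in> J"
    by (intro ideal.subspace_add[OF J] ideal.subspace_scale[OF J] mult)
  then show ?case by (simp add: peval_mult Const_hom algebra_simps)
qed

section \<open>Univariate polynomials evaluated at an element of the polynomial ring\<close>

definition subst_poly :: "'n::finite cpoly \<Rightarrow> complex poly \<Rightarrow> 'n cpoly" where
  "subst_poly t q = poly (map_poly Const q) t"

lemma subst_poly_0: "subst_poly t 0 = 0"
  by (simp add: subst_poly_def)

lemma subst_poly_pCons: "subst_poly t (pCons a q) = Const a + t * subst_poly t q"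
  by (simp add: subst_poly_def map_poly_pCons Const_hom)

lemma subst_poly_add:
  fixes t :: "'a::finite cpoly"
  shows "subst_poly t (p + q) = subst_poly t p + subst_poly t q"
proof -
  have "map_poly Const (p + q) = (map_poly Const p + map_poly Const q :: 'a cpoly poly)"
    by (rule poly_eqI) (simp add: coeff_map_poly Const_hom)
  then show ?thesis by (simp only: subst_poly_def poly_add)
qed

lemma subst_poly_smult: "subst_poly t (smult c q) = Const c * subst_poly t q"
  by (induction q) (simp_all add: subst_poly_0 subst_poly_pCons Const_hom algebra_simps)

lemma subst_poly_mult: "subst_poly t (p * q) = subst_poly t p * subst_poly t q"
  by (induction p)
    (simp_all add: subst_poly_0 subst_poly_pCons subst_poly_add subst_poly_smult Const_hom algebra_simps)

lemma subst_poly_sum: "subst_poly t (\<Sum>a\<in>S. F a) = (\<Sum>a\<in>S. subst_poly t (F a))"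
  by (induction S rule: infinite_finite_induct) (simp_all add: subst_poly_0 subst_poly_add)

lemma subst_poly_prod: "subst_poly t (\<Prod>a\<in>S. F a) = (\<Prod>a\<in>S. subst_poly t (F a))"
  by (induction S rule: infinite_finite_induct)
    (simp_all add: subst_poly_mult one_pCons subst_poly_0 subst_poly_pCons Const_hom)

text \<open>Over the complex numbers \<open>q\<close> splits into linear factors, and a prime ideal
  containing the product of their values at \<open>t\<close> contains one of them. The leading
  constant cannot lie in \<open>J\<close>, being a unit.\<close>

lemma linear_factor_in_prime_ideal:
  fixes t :: "'n::finite cpoly"
  assumes J: "ideal.subspace J" and proper: "1 \<notin> J"
    and prime: "\<And>g h. g * h \<in> J \<Longrightarrow> g \<in> J \<or> h \<in> J"
    and "q \<noteq> 0" "subst_poly t q \<in> J"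
  shows "\<exists>c. t - Const c \<in> J"
  using assms(4,5)
proof (induction "degree q" arbitrary: q)
  case 0
  then obtain a where a: "q = [:a:]" "a \<noteq> 0" by (metis degree_eq_zeroE pCons_0_0)
  then have "Const (inverse a) * Const a \<in> J"
    using 0 by (intro ideal.subspace_scale[OF J]) (simp add: subst_poly_pCons subst_poly_0)
  then show ?case using a proper by (simp add: Const_inverse)
next
  case (Suc n)
  then have "\<not> constant (poly q)" by (simp add: constant_degree)
  then obtain z where "poly q z = 0" using fundamental_theorem_of_algebra by blast
  then obtain r where r: "q = [:- z, 1:] * r" by (metis poly_eq_0_iff_dvd dvdE)
  then have "r \<noteq> 0" using Suc.prems by auto
  then have deg: "n = degree r" using r Suc(2) by (simp add: degree_mult_eq del: mult_pCons_left)
  have "Const (- z) + Const z = 0" by (simp add: Const_hom(3)[symmetric] Const_hom(1))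
  then have "subst_poly t [:- z, 1:] = t - Const z"
    by (simp add: subst_poly_pCons subst_poly_0 Const_hom eq_neg_iff_add_eq_0)
  then have "t - Const z \<in> J \<or> subst_poly t r \<in> J"
    using prime Suc.prems(2) unfolding r subst_poly_mult by metis
  then show ?case using Suc.hyps(1)[OF deg \<open>r \<noteq> 0\<close>] by blast
qed

section \<open>The Nullstellensatz by dimension and cardinality\<close>

interpretation cpoly: vector_space "\<lambda>c (p :: 'n::finite cpoly). Const c * p"
  by unfold_locales (simp_all add: Const_hom algebra_simps)

declare cpoly.scale_scale [simp del]

lemma cpoly_in_span_monomials:
  assumes "Poly_Mapping.keys p \<subseteq> K"
  shows "p \<in> cpoly.span ((\<lambda>m. Poly_Mapping.single m 1) ` K)"
proof -
  have "(\<Sum>m\<in>Poly_Mapping.keys p. Const (Poly_Mapping.lookup p m) * Poly_Mapping.single m 1)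
      \<in> cpoly.span ((\<lambda>m. Poly_Mapping.single m 1) ` K)"
    using assms by (intro cpoly.span_sum cpoly.span_scale cpoly.span_base) auto
  then show ?thesis using cpoly_eq_sum_singles[of p] by (simp add: Const_mult_single)
qed

lemma cpoly_exponents_bounded:
  fixes p :: "'n::finite cpoly"
  shows "\<exists>d. Poly_Mapping.keys p \<subseteq> {m. \<forall>i. Poly_Mapping.lookup m i < d}"
proof -
  let ?E = "(\<lambda>(m, i). Poly_Mapping.lookup m i) ` (Poly_Mapping.keys p \<times> UNIV)"
  have "finite ?E" by simp
  then obtain d where "\<forall>e\<in>?E. e < d" using finite_nat_set_iff_bounded by blast
  then show ?thesis by (intro exI[of _ d]) auto
qed

text \<open>
  Partial fractions: modulo \<open>J\<close>, an element \<open>g c\<close> is \<open>f ^ k / (t - c)\<close>. Only finitely many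
  of these can lie in a finite-dimensional space unless \<open>t\<close> is algebraic, but the uncountably many
  \<open>c\<close> are distributed over countably many \<open>k\<close> and spaces of bounded exponents.
\<close>
lemma Const_congruent_of_maximal:
  fixes t f :: "'n::finite cpoly"
  assumes J: "ideal.subspace J" and avoid: "\<And>k. f ^ k \<notin> J"
    and unit: "\<And>g. g \<notin> J \<Longrightarrow> \<exists>h k. f ^ k - g * h \<in> J"
  shows "\<exists>c. t - Const c \<in> J"
proof (rule ccontr)
  assume no: "\<not> ?thesis"
  have prime: "a \<in> J \<or> b \<in> J" if "a * b \<in> J" for a b
    using J avoid unit that by (rule ideal_maximal_avoiding_powers_prime)
  have proper: "1 \<notin> J" using avoid[of 0] by simp
  have "\<forall>c. \<exists>h k. f ^ k - (t - Const c) * h \<in> J" using no unit by blast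
  then obtain g k where gk: "\<And>c. f ^ k c - (t - Const c) * g c \<in> J" by metis
  obtain d where d: "\<And>c. Poly_Mapping.keys (g c) \<subseteq> {m. \<forall>i. Poly_Mapping.lookup m i < d c}"
    using cpoly_exponents_bounded[of "g _"] by (atomize_elim, intro choice allI)
  \<comment> \<open>There are only countably many pairs of a power and an exponent bound, so some
    fibre is uncountable. On it all \<open>g c\<close> belong to one finite-dimensional space and
    share the same power of \<open>f\<close>.\<close>
  define fib where "fib = (\<lambda>(k', d'). {c. k c = k' \<and> d c = d'})"
  have "(\<Union>z. fib z) = UNIV" by (auto simp: fib_def)
  then have "\<not> (\<forall>z. countable (fib z))"
    using uncountable_UNIV_complex countable_UN[of UNIV fib] by auto
  then obtain k0 d0 where "\<not> countable (fib (k0, d0))" by auto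
  then have inf: "infinite (fib (k0, d0))" using countable_finite by blast
  let ?C = "fib (k0, d0)"
  have gc: "f ^ k0 - (t - Const c) * g c \<in> J" if "c \<in> ?C" for c
    using gk[of c] that by (simp add: fib_def)
  \<comment> \<open>If \<open>g a = g b\<close>, subtracting the two relations leaves
    \<open>(a - b) * g a\<close> in \<open>J\<close>; then \<open>g a\<close>, and with it
    \<open>f ^ k0\<close>, would lie in \<open>J\<close>.\<close>
  have inj: "inj_on g ?C"
  proof (rule inj_onI, rule ccontr)
    fix a b assume ab: "a \<in> ?C" "b \<in> ?C" "g a = g b" "a \<noteq> b"
    let ?u = "Const (inverse (a - b))"
    have hom: "Const a = Const (a - b) + Const b" by (simp add: Const_hom(3)[symmetric])
    have "?u * ((f ^ k0 - (t - Const a) * g a) - (f ^ k0 - (t - Const b) * g b)) \<in> J"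
      by (intro ideal.subspace_scale[OF J] ideal.subspace_diff[OF J] gc ab)
    also have "?u * ((f ^ k0 - (t - Const a) * g a) - (f ^ k0 - (t - Const b) * g b))
        = (?u * Const (a - b)) * g a"
      unfolding hom using ab(3) by (simp add: algebra_simps)
    finally have "g a \<in> J" using ab by (simp add: Const_inverse)
    then have "(f ^ k0 - (t - Const a) * g a) + (t - Const a) * g a \<in> J"
      by (intro ideal.subspace_add[OF J] ideal.subspace_scale[OF J] gc ab)
    then show False using avoid by simp
  qed
  let ?K = "(\<lambda>m. Poly_Mapping.single m 1) ` {m :: 'n \<Rightarrow>\<^sub>0 nat. \<forall>i. Poly_Mapping.lookup m i < d0}"
  have "g ` ?C \<subseteq> cpoly.span ?K"
    using d by (intro image_subsetI cpoly_in_span_monomials) (auto simp: fib_def)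
  moreover have "finite ?K" by (intro finite_imageI finite_bounded_exponents)
  moreover have "infinite (g ` ?C)" using inf inj finite_image_iff by blast
  ultimately have "cpoly.dependent (g ` ?C)" using cpoly.independent_span_bound by blast
  then obtain T u where T: "finite T" "T \<subseteq> g ` ?C"
    and rel: "(\<Sum>v\<in>T. Const (u v) * v) = 0" and nz: "\<exists>v\<in>T. u v \<noteq> 0"
    unfolding cpoly.dependent_explicit by blast
  from T(2) obtain S where S: "S \<subseteq> ?C" "T = g ` S" by (meson subset_imageE)
  have injS: "inj_on g S" using inj S inj_on_subset by blast
  then have finS: "finite S" using T S finite_image_iff by blast
  define a where "a = (\<lambda>c. u (g c))"
  have rel: "(\<Sum>c\<in>S. Const (a c) * g c) = 0"
    using rel unfolding S sum.reindex[OF injS] by (simp add: a_def)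
  obtain c0 where c0: "c0 \<in> S" "a c0 \<noteq> 0" using nz S by (auto simp: a_def)
  \<comment> \<open>The numerator of the sum of the fractions \<open>a c / (T - c)\<close> over
    their common denominator. At \<open>c0\<close> only the summand for \<open>c0\<close> survives,
    which shows that \<open>q\<close> is nonzero.\<close>
  define q where "q = (\<Sum>c\<in>S. smult (a c) (\<Prod>b\<in>S - {c}. [:- b, 1:]))"
  have "poly q c0 = (\<Sum>c\<in>S. a c * (\<Prod>b\<in>S - {c}. c0 - b))"
    by (simp add: q_def poly_sum poly_prod)
  also have "\<dots> = (\<Sum>c\<in>S. if c = c0 then a c * (\<Prod>b\<in>S - {c}. c0 - b) else 0)"
    using finS c0 by (intro sum.cong) auto
  also have "\<dots> = a c0 * (\<Prod>b\<in>S - {c0}. c0 - b)" using finS c0 by (simp add: sum.delta)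
  also have "\<dots> \<noteq> 0" using c0 finS by auto
  finally have "q \<noteq> 0" by auto
  have neg: "Const (- b) = - Const b" for b :: complex
    by (simp add: eq_neg_iff_add_eq_0 Const_hom(3)[symmetric] Const_hom(1))
  have subst_q: "subst_poly t q = (\<Sum>c\<in>S. Const (a c) * (\<Prod>b\<in>S - {c}. t - Const b))"
    by (simp add: q_def subst_poly_sum subst_poly_smult subst_poly_prod subst_poly_pCons
        subst_poly_0 Const_hom neg)
  \<comment> \<open>Clearing denominators: each relation is multiplied by the factors for the other
    points. The terms with \<open>g c\<close> then share the full product over \<open>S\<close> and
    cancel by \<open>rel\<close>.\<close>
  have "(\<Sum>c\<in>S. (Const (a c) * (\<Prod>b\<in>S - {c}. t - Const b)) * (f ^ k0 - (t - Const c) * g c)) \<in> J"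
    using S gc by (intro ideal.subspace_sum[OF J] ideal.subspace_scale[OF J]) auto
  also have "(\<Sum>c\<in>S. (Const (a c) * (\<Prod>b\<in>S - {c}. t - Const b)) * (f ^ k0 - (t - Const c) * g c))
      = (\<Sum>c\<in>S. Const (a c) * (\<Prod>b\<in>S - {c}. t - Const b) * f ^ k0
          - (\<Prod>b\<in>S. t - Const b) * (Const (a c) * g c))"
    using finS by (intro sum.cong) (simp_all add: prod.remove algebra_simps)
  also have "\<dots> = subst_poly t q * f ^ k0"
    unfolding sum_subtractf sum_distrib_left[symmetric] rel subst_q by (simp add: sum_distrib_right)
  finally have "subst_poly t q \<in> J" using prime avoid[of k0] by blast
  have "\<exists>c. t - Const c \<in> J"
    using J proper prime \<open>q \<noteq> 0\<close> \<open>subst_poly t q \<in> J\<close>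
    by (rule linear_factor_in_prime_ideal)
  then show False using no by contradiction
qed

text \<open>If no power of \<open>f\<close> lay in \<open>I\<close>, a maximal \<open>J\<close>
  above \<open>I\<close> avoiding these powers would make every variable congruent to a constant.
  These constants form a zero of \<open>I\<close>, so \<open>f\<close> vanishes there and is itself
  in \<open>J\<close>.\<close>

lemma nullstellensatz:
  fixes f :: "'n::finite cpoly"
  assumes I: "ideal.subspace I"
    and vanish: "\<And>x. (\<forall>p\<in>I. peval (\<lambda>c. c) x p = 0) \<Longrightarrow> peval (\<lambda>c. c) x f = 0"
  shows "\<exists>k. f ^ k \<in> I"
proof (rule ccontr)
  assume "\<not> ?thesis"
  then obtain J where J: "ideal.subspace J" "I \<subseteq> J" and avoid: "\<And>k. f ^ k \<notin> J"
    and unit: "\<And>g. g \<notin> J \<Longrightarrow> \<exists>h k. f ^ k - g * h \<in> J"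
    using ideal_maximal_avoiding_powers[OF I] by metis
  have "\<exists>c. Var i - Const c \<in> J" for i
    using J(1) avoid unit by (rule Const_congruent_of_maximal)
  then obtain x where x: "\<And>i. Var i - Const (x i) \<in> J" by metis
  have eval: "p - Const (peval (\<lambda>c. c) x p) \<in> J" for p
    using minus_Const_eval_in_ideal[OF J(1) x] .
  have "peval (\<lambda>c. c) x p = 0" if "p \<in> I" for p
  proof (rule ccontr)
    let ?v = "peval (\<lambda>c. c) x p"
    assume "?v \<noteq> 0"
    \<comment> \<open>Both \<open>p\<close> and its difference from its value lie in
      \<open>J\<close>; a nonzero value would put \<open>1 = f ^ 0\<close> into
      \<open>J\<close>.\<close>
    have "Const (inverse ?v) * (p - (p - Const ?v)) \<in> J"
      using that J(2) by (intro ideal.subspace_scale[OF J(1)] ideal.subspace_diff[OF J(1)] eval) auto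
    then show False using avoid[of 0] \<open>?v \<noteq> 0\<close> by (simp add: Const_inverse)
  qed
  then have "peval (\<lambda>c. c) x f = 0" using vanish by blast
  then show False using eval[of f] avoid[of 1] by (simp add: Const_hom)
qed

section \<open>Homogeneous parts and the grading\<close>

definition hom_part :: "nat \<Rightarrow> 'n::finite cpoly \<Rightarrow> 'n cpoly" where
  "hom_part e = Poly_Mapping.mapp (\<lambda>m c. c when mdeg m = e)"

lemma lookup_hom_part:
  "Poly_Mapping.lookup (hom_part e p) m = (Poly_Mapping.lookup p m when mdeg m = e)"
  by (auto simp: hom_part_def lookup_mapp when_def in_keys_iff)

lemma mdeg_hom_part: "m \<in> Poly_Mapping.keys (hom_part e p) \<Longrightarrow> mdeg m = e"
  by (auto simp: in_keys_iff lookup_hom_part when_def split: if_splits)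

lemma hom_part_add: "hom_part e (p + q) = hom_part e p + hom_part e q"
  by (rule poly_mapping_eqI) (simp add: lookup_hom_part lookup_add when_add_distrib)

lemma hom_part_0: "hom_part e 0 = 0"
  by (rule poly_mapping_eqI) (simp add: lookup_hom_part)

lemma hom_part_sum: "hom_part e (\<Sum>a\<in>S. F a) = (\<Sum>a\<in>S. hom_part e (F a))"
  by (induction S rule: infinite_finite_induct) (simp_all add: hom_part_0 hom_part_add)

lemma hom_part_single:
  "hom_part e (Poly_Mapping.single m c) = (if mdeg m = e then Poly_Mapping.single m c else 0)"
  by (rule poly_mapping_eqI) (auto simp: lookup_hom_part lookup_single when_def)

lemma mdeg_add: "mdeg (m + m') = mdeg m + mdeg m'"
  by (simp add: mdeg_def lookup_add sum.distrib)

text \<open>Bilinearity reduces this to monomials, whose degrees add. The case distinction keeps the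
  truncated difference \<open>e - d\<close> from producing a spurious part of degree 0.\<close>

lemma hom_part_mult_homogeneous:
  fixes p q :: "'a::finite cpoly"
  assumes "homogeneous d p"
  shows "hom_part e (q * p) = (if d \<le> e then hom_part (e - d) q * p else 0)"
proof -
  have single: "hom_part e (Poly_Mapping.single m c * Poly_Mapping.single m' c')
      = (if d \<le> e then hom_part (e - d) (Poly_Mapping.single m c) * Poly_Mapping.single m' c' else 0)"
    if "mdeg m' = d" for m c m' c'
    using that by (auto simp: mult_single hom_part_single mdeg_add)
  let ?q = "\<Sum>m\<in>Poly_Mapping.keys q. Poly_Mapping.single m (Poly_Mapping.lookup q m)"
  let ?p = "\<Sum>m\<in>Poly_Mapping.keys p. Poly_Mapping.single m (Poly_Mapping.lookup p m)"
  have "hom_part e (?q * ?p) = (if d \<le> e then hom_part (e - d) ?q * ?p else 0)"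
    using assms by (simp add: homogeneous_def sum_product hom_part_sum single)
  then show ?thesis unfolding cpoly_eq_sum_singles[symmetric] .
qed

text \<open>Coefficients are attached to indices rather than to elements of \<open>range P\<close>,
  as \<open>P\<close> may take a value several times.\<close>

lemma ideal_span_range:
  fixes P :: "'m::finite \<Rightarrow> 'a::comm_ring_1"
  assumes "p \<in> ideal.span (range P)"
  shows "\<exists>Q. p = (\<Sum>i\<in>UNIV. Q i * P i)"
  using assms
proof (induction rule: ideal.span_induct_alt)
  case base
  show ?case by (intro exI[of _ "\<lambda>_. 0"]) simp
next
  case (step c x y)
  then obtain Q j where Q: "y = (\<Sum>i\<in>UNIV. Q i * P i)" "x = P j" by auto
  have "(\<Sum>i\<in>UNIV. (Q i + (if i = j then c else 0)) * P i)
      = (\<Sum>i\<in>UNIV. Q i * P i) + (\<Sum>i\<in>UNIV. if i = j then c * P i else 0)"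
    unfolding sum.distrib[symmetric] by (intro sum.cong) (auto simp: algebra_simps)
  then have "c * x + y = (\<Sum>i\<in>UNIV. (Q i + (if i = j then c else 0)) * P i)"
    using Q by (simp add: sum.delta)
  then show ?case by (rule exI[of _ "\<lambda>i. Q i + (if i = j then c else 0)"])
qed

text \<open>In degree 0 the polynomial is constant, and vanishing at the origin makes it zero, which
  is homogeneous of degree 1 as well.\<close>

lemma homogeneous_pos_degree:
  assumes "homogeneous d p" "peval (\<lambda>c. c) (\<lambda>_. 0) p = 0"
  shows "\<exists>d>0. homogeneous d p"
proof (cases "d = 0")
  case True
  have "m = 0" if "m \<in> Poly_Mapping.keys p" for m
    using that assms(1) True by (intro poly_mapping_eqI) (auto simp: homogeneous_def mdeg_def)
  then have "Poly_Mapping.keys p \<subseteq> {0}" by blast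
  then have "peval (\<lambda>c. c) (\<lambda>_. 0) p = Poly_Mapping.lookup p 0"
    by (subst peval_superset[of _ "{0}"]) auto
  then have "0 \<notin> Poly_Mapping.keys p" using assms(2) by (simp add: in_keys_iff)
  then have "Poly_Mapping.keys p = {}" using \<open>Poly_Mapping.keys p \<subseteq> {0}\<close> by blast
  then show ?thesis by (intro exI[of _ 1]) (simp add: homogeneous_def)
qed (use assms in auto)

section \<open>Graded Nakayama and finiteness\<close>

lemma finite_morphism_of_Var_powers:
  fixes P :: "'m::finite \<Rightarrow> 'n::finite cpoly"
  assumes hom: "\<And>i. homogeneous (d i) (P i)" and pos: "\<And>i. d i > 0"
    and pow: "\<And>i. Var i ^ N i \<in> ideal.span (range P)"
  shows "finite_morphism P"
proof -
  interpret M: module "pullback_scale P" by (rule module_pullback_scale)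
  define B where "B = (\<lambda>m. Poly_Mapping.single m (1::complex)) `
    {m :: 'n \<Rightarrow>\<^sub>0 nat. \<forall>i. Poly_Mapping.lookup m i < N i}"
  have "finite B" unfolding B_def using finite_bounded_exponents by blast
  have single: "Poly_Mapping.single m c \<in> M.span B" for m c
  proof (induction "mdeg m" arbitrary: m c rule: less_induct)
    case less
    show ?case
    proof (cases "\<forall>i. Poly_Mapping.lookup m i < N i")
      case True
      then have "pullback_scale P (Const c) (Poly_Mapping.single m 1) \<in> M.span B"
        by (intro M.span_scale M.span_base) (auto simp: B_def)
      then show ?thesis by (simp add: pullback_scale_def comorphism_hom Const_mult_single)
    next
      case False
      then obtain i where i: "Poly_Mapping.lookup m i \<ge> N i" by (auto simp: not_less)
      \<comment> \<open>The monomial is divisible by \<open>Var i ^ N i\<close>; the inequality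
        \<open>i\<close> makes the truncated subtraction of exponents exact.\<close>
      have "m - Poly_Mapping.single i (N i) + Poly_Mapping.single i (N i) = m"
        using i by (intro poly_mapping_eqI) (auto simp: lookup_add lookup_minus lookup_single when_def)
      then have "Poly_Mapping.single m c
          = Poly_Mapping.single (m - Poly_Mapping.single i (N i)) c * Var i ^ N i"
        by (simp add: Var_power mult_single)
      then have "Poly_Mapping.single m c \<in> ideal.span (range P)"
        using pow ideal.span_scale by metis
      then obtain Q where Q: "Poly_Mapping.single m c = (\<Sum>j\<in>UNIV. Q j * P j)"
        using ideal_span_range by blast
      \<comment> \<open>Taking parts of degree \<open>mdeg m\<close> replaces each
        \<open>Q j\<close> by its part of degree \<open>mdeg m - d j\<close>. This is below
        \<open>mdeg m\<close> because \<open>d j\<close> is positive, so the induction hypothesis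
        applies.\<close>
      have "Poly_Mapping.single m c = hom_part (mdeg m) (Poly_Mapping.single m c)"
        by (simp add: hom_part_single)
      also have "\<dots> = (\<Sum>j\<in>UNIV. if d j \<le> mdeg m then hom_part (mdeg m - d j) (Q j) * P j else 0)"
        unfolding Q by (simp add: hom_part_sum hom_part_mult_homogeneous[OF hom])
      also have "\<dots> \<in> M.span B"
      proof (rule M.span_sum)
        fix j
        have "hom_part (mdeg m - d j) (Q j) \<in> M.span B" if "d j \<le> mdeg m"
        proof (subst cpoly_eq_sum_singles, rule M.span_sum, rule less)
          fix m' assume "m' \<in> Poly_Mapping.keys (hom_part (mdeg m - d j) (Q j))"
          then show "mdeg m' < mdeg m" using mdeg_hom_part pos[of j] that by fastforce
        qed
        \<comment> \<open>Multiplication by \<open>P j\<close> is the scalar action of the target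
          coordinate \<open>Var j\<close>, so it preserves the span.\<close>
        then have "pullback_scale P (Var j) (hom_part (mdeg m - d j) (Q j)) \<in> M.span B"
          if "d j \<le> mdeg m" using that by (intro M.span_scale)
        then show "(if d j \<le> mdeg m then hom_part (mdeg m - d j) (Q j) * P j else 0) \<in> M.span B"
          by (simp add: pullback_scale_def comorphism_hom mult.commute M.span_zero)
      qed
      finally show ?thesis .
    qed
  qed
  have "p \<in> M.span B" for p
    by (subst cpoly_eq_sum_singles) (intro M.span_sum single)
  then show ?thesis unfolding finite_morphism_def using \<open>finite B\<close> by blast
qed

theorem theorem1p3:
  fixes P :: "'n::finite \<Rightarrow> 'n cpoly"
  assumes "\<forall>i. \<exists>d. homogeneous d (P i)"
    and "point_map P -` {0} = {0}"
  shows "finite_morphism P"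
proof -
  have zeros: "(\<forall>i. peval (\<lambda>c. c) x (P i) = 0) \<longleftrightarrow> x = (\<lambda>_. 0)" for x
  proof -
    have "(\<forall>i. peval (\<lambda>c. c) x (P i) = 0) \<longleftrightarrow> (\<chi> i. x i) \<in> point_map P -` {0}"
      by (simp add: point_map_def vec_eq_iff)
    also have "\<dots> \<longleftrightarrow> x = (\<lambda>_. 0)" unfolding assms(2) by (auto simp: vec_eq_iff)
    finally show ?thesis .
  qed
  have "\<forall>i. \<exists>d>0. homogeneous d (P i)"
    using assms(1) zeros homogeneous_pos_degree by blast
  then obtain d where d: "\<And>i. d i > 0" "\<And>i. homogeneous (d i) (P i)" by metis
  \<comment> \<open>Every common zero of the ideal is the origin, where all variables
    vanish.\<close>
  have "\<exists>k. Var j ^ k \<in> ideal.span (range P)" for j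
  proof (rule nullstellensatz)
    fix x assume "\<forall>p\<in>ideal.span (range P). peval (\<lambda>c. c) x p = 0"
    then have "\<forall>i. peval (\<lambda>c. c) x (P i) = 0" by (auto intro: ideal.span_base)
    then show "peval (\<lambda>c. c) x (Var j) = 0" using zeros by (simp add: peval_Var)
  qed (rule ideal.subspace_span)
  then obtain N where N: "\<And>j. Var j ^ N j \<in> ideal.span (range P)" by metis
  show ?thesis using d(2,1) N by (rule finite_morphism_of_Var_powers)
qed

end
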